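(* Let $p$ be an odd prime number. Then the domination number of the undirected zero divisor graph $\overline{\Gamma}(\mathbb{Z}_p[i,j,k])$ is $p+1$.
   Context: $\mathbb{Z}_n[i,j,k]=\{a+bi+cj+dk: a,b,c,d\in\mathbb{Z}_n\}$ is the ring of Lipschitz quaternions modulo $n$, with $i^2=j^2=k^2=ijk=-1$ and coefficients in $\mathbb{Z}_n$ (integers modulo $n$) central. For a ring $R$, an element $x$ is a zero divisor if there is a nonzero $y\in R$ with $xy=0$ or $yx=0$. The undirected zero divisor graph $\overline{\Gamma}(R)$ is the simple graph whose vertices are the nonzero zero divisors of $R$, with distinct $x,y$ adjacent iff $xy=0$ or $yx=0$. A dominating set of a graph $G$ is a set $D$ of vertices such that every vertex not in $D$ is adjacent to at least one member of $D$; the domination number is the minimum cardinality of a dominating set. *)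

theory Defs
  imports "HOL-Number_Theory.Residues" "Graph_Theory.Pair_Digraph"
begin

section \<open>Quaternion rings\<close>

text \<open>The tuple \<open>(a, b, c, d)\<close> stands for \<open>a + bi + cj + dk\<close>.  The product formula is the bilinear
  extension of \<open>i\<^sup>2 = j\<^sup>2 = k\<^sup>2 = ijk = -1\<close> with central coefficients.\<close>

type_synonym 'a quat = "'a \<times> 'a \<times> 'a \<times> 'a"

definition quaternion_ring :: "('a, 'm) ring_scheme \<Rightarrow> 'a quat ring" where
  "quaternion_ring R =
    \<lparr>carrier = carrier R \<times> carrier R \<times> carrier R \<times> carrier R,
     monoid.mult = (\<lambda>(a, b, c, d) (a', b', c', d').
       (a \<otimes>\<^bsub>R\<^esub> a' \<ominus>\<^bsub>R\<^esub> b \<otimes>\<^bsub>R\<^esub> b' \<ominus>\<^bsub>R\<^esub> c \<otimes>\<^bsub>R\<^esub> c' \<ominus>\<^bsub>R\<^esub> d \<otimes>\<^bsub>R\<^esub> d',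
        a \<otimes>\<^bsub>R\<^esub> b' \<oplus>\<^bsub>R\<^esub> b \<otimes>\<^bsub>R\<^esub> a' \<oplus>\<^bsub>R\<^esub> c \<otimes>\<^bsub>R\<^esub> d' \<ominus>\<^bsub>R\<^esub> d \<otimes>\<^bsub>R\<^esub> c',
        a \<otimes>\<^bsub>R\<^esub> c' \<ominus>\<^bsub>R\<^esub> b \<otimes>\<^bsub>R\<^esub> d' \<oplus>\<^bsub>R\<^esub> c \<otimes>\<^bsub>R\<^esub> a' \<oplus>\<^bsub>R\<^esub> d \<otimes>\<^bsub>R\<^esub> b',
        a \<otimes>\<^bsub>R\<^esub> d' \<oplus>\<^bsub>R\<^esub> b \<otimes>\<^bsub>R\<^esub> c' \<ominus>\<^bsub>R\<^esub> c \<otimes>\<^bsub>R\<^esub> b' \<oplus>\<^bsub>R\<^esub> d \<otimes>\<^bsub>R\<^esub> a')),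
     one = (\<one>\<^bsub>R\<^esub>, \<zero>\<^bsub>R\<^esub>, \<zero>\<^bsub>R\<^esub>, \<zero>\<^bsub>R\<^esub>),
     zero = (\<zero>\<^bsub>R\<^esub>, \<zero>\<^bsub>R\<^esub>, \<zero>\<^bsub>R\<^esub>, \<zero>\<^bsub>R\<^esub>),
     add = (\<lambda>(a, b, c, d) (a', b', c', d').
       (a \<oplus>\<^bsub>R\<^esub> a', b \<oplus>\<^bsub>R\<^esub> b', c \<oplus>\<^bsub>R\<^esub> c', d \<oplus>\<^bsub>R\<^esub> d'))\<rparr>"

lemma ring_quaternion_ring:
  fixes R (structure)
  assumes "cring R"
  shows "ring (quaternion_ring R)"
proof -
  interpret cring R by fact
  show ?thesis
  proof (intro ringI abelian_groupI monoidI)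
    fix x assume "x \<in> carrier (quaternion_ring R)"
    then obtain a b c d where x: "x = (a, b, c, d)"
      and abcd: "a \<in> carrier R" "b \<in> carrier R" "c \<in> carrier R" "d \<in> carrier R"
      by (auto simp: quaternion_ring_def)
    then show "\<exists>y\<in>carrier (quaternion_ring R).
        y \<oplus>\<^bsub>quaternion_ring R\<^esub> x = \<zero>\<^bsub>quaternion_ring R\<^esub>"
      by (intro bexI[of _ "(\<ominus> a, \<ominus> b, \<ominus> c, \<ominus> d)"]) (auto simp: quaternion_ring_def l_neg)
  qed (auto simp: quaternion_ring_def minus_eq l_distr r_distr l_minus r_minus minus_add m_ac a_ac)
qed

lemma quaternion_units:
  fixes R (structure)
  assumes "cring R"
  defines "Q \<equiv> quaternion_ring R"
  defines "i \<equiv> (\<zero>, \<one>, \<zero>, \<zero>)" and "j \<equiv> (\<zero>, \<zero>, \<one>, \<zero>)" and "k \<equiv> (\<zero>, \<zero>, \<zero>, \<one>)"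
  shows "i \<otimes>\<^bsub>Q\<^esub> i = (\<ominus> \<one>, \<zero>, \<zero>, \<zero>)"
    and "j \<otimes>\<^bsub>Q\<^esub> j = (\<ominus> \<one>, \<zero>, \<zero>, \<zero>)"
    and "k \<otimes>\<^bsub>Q\<^esub> k = (\<ominus> \<one>, \<zero>, \<zero>, \<zero>)"
    and "i \<otimes>\<^bsub>Q\<^esub> j \<otimes>\<^bsub>Q\<^esub> k = (\<ominus> \<one>, \<zero>, \<zero>, \<zero>)"
proof -
  interpret cring R by fact
  show "i \<otimes>\<^bsub>Q\<^esub> i = (\<ominus> \<one>, \<zero>, \<zero>, \<zero>)"
    and "j \<otimes>\<^bsub>Q\<^esub> j = (\<ominus> \<one>, \<zero>, \<zero>, \<zero>)"
    and "k \<otimes>\<^bsub>Q\<^esub> k = (\<ominus> \<one>, \<zero>, \<zero>, \<zero>)"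
    and "i \<otimes>\<^bsub>Q\<^esub> j \<otimes>\<^bsub>Q\<^esub> k = (\<ominus> \<one>, \<zero>, \<zero>, \<zero>)"
    by (simp_all add: Q_def i_def j_def k_def quaternion_ring_def minus_eq)
qed

lemma quaternion_decomposition:
  fixes R (structure)
  assumes "cring R"
    and "a \<in> carrier R" "b \<in> carrier R" "c \<in> carrier R" "d \<in> carrier R"
  defines "Q \<equiv> quaternion_ring R"
  defines "\<iota> \<equiv> (\<lambda>r. (r, \<zero>, \<zero>, \<zero>))"
  shows "(a, b, c, d) = \<iota> a \<oplus>\<^bsub>Q\<^esub> \<iota> b \<otimes>\<^bsub>Q\<^esub> (\<zero>, \<one>, \<zero>, \<zero>) \<oplus>\<^bsub>Q\<^esub> \<iota> c \<otimes>\<^bsub>Q\<^esub> (\<zero>, \<zero>, \<one>, \<zero>)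
      \<oplus>\<^bsub>Q\<^esub> \<iota> d \<otimes>\<^bsub>Q\<^esub> (\<zero>, \<zero>, \<zero>, \<one>)"
proof -
  interpret cring R by fact
  show ?thesis
    using assms(2-5) by (simp add: Q_def \<iota>_def quaternion_ring_def minus_eq)
qed

lemma quaternion_coefficients_central:
  fixes R (structure)
  assumes "cring R" and "r \<in> carrier R" and "x \<in> carrier (quaternion_ring R)"
  shows "(r, \<zero>, \<zero>, \<zero>) \<otimes>\<^bsub>quaternion_ring R\<^esub> x = x \<otimes>\<^bsub>quaternion_ring R\<^esub> (r, \<zero>, \<zero>, \<zero>)"
proof -
  interpret cring R by fact
  show ?thesis
    using assms(2,3) by (auto simp: quaternion_ring_def minus_eq m_comm)
qed

abbreviation lipschitz_quaternions_mod :: "nat \<Rightarrow> int quat ring" where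
  "lipschitz_quaternions_mod n \<equiv> quaternion_ring (residue_ring (int n))"


section \<open>Zero divisor graphs\<close>

definition zero_divisors :: "('a, 'm) ring_scheme \<Rightarrow> 'a set" where
  "zero_divisors R = {x \<in> carrier R. \<exists>y \<in> carrier R.
     y \<noteq> \<zero>\<^bsub>R\<^esub> \<and> (x \<otimes>\<^bsub>R\<^esub> y = \<zero>\<^bsub>R\<^esub> \<or> y \<otimes>\<^bsub>R\<^esub> x = \<zero>\<^bsub>R\<^esub>)}"

text \<open>An undirected simple graph is represented, as usual in this graph library, by a symmetric
  loop-free digraph: the edge \<open>{x, y}\<close> is given by the two arcs \<open>(x, y)\<close> and \<open>(y, x)\<close>.\<close>

definition zero_divisor_graph :: "('a, 'm) ring_scheme \<Rightarrow> 'a pair_pre_digraph" where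
  "zero_divisor_graph R =
    \<lparr>pverts = zero_divisors R - {\<zero>\<^bsub>R\<^esub>},
     parcs = {(x, y). x \<in> zero_divisors R - {\<zero>\<^bsub>R\<^esub>} \<and> y \<in> zero_divisors R - {\<zero>\<^bsub>R\<^esub>} \<and> x \<noteq> y \<and>
       (x \<otimes>\<^bsub>R\<^esub> y = \<zero>\<^bsub>R\<^esub> \<or> y \<otimes>\<^bsub>R\<^esub> x = \<zero>\<^bsub>R\<^esub>)}\<rparr>"

lemma pair_graph_zero_divisor_graph:
  assumes "finite (carrier R)"
  shows "pair_graph (zero_divisor_graph R)"
proof -
  have fin: "finite (zero_divisors R - {\<zero>\<^bsub>R\<^esub>})"
    using assms by (simp add: zero_divisors_def)
  have "finite (parcs (zero_divisor_graph R))"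
    by (rule finite_subset[OF _ finite_cartesian_product[OF fin fin]])
      (auto simp: zero_divisor_graph_def)
  with fin show ?thesis
    by unfold_locales (auto simp: zero_divisor_graph_def symmetric_def sym_def)
qed


section \<open>Domination\<close>

definition dominating_set :: "'a pair_pre_digraph \<Rightarrow> 'a set \<Rightarrow> bool" where
  "dominating_set G D \<longleftrightarrow>
    D \<subseteq> pverts G \<and> (\<forall>v \<in> pverts G - D. \<exists>u \<in> D. (u, v) \<in> parcs G)"

text \<open>Finiteness of \<open>D\<close> is required because infinite sets have \<open>card\<close> 0.\<close>

definition domination_number :: "'a pair_pre_digraph \<Rightarrow> nat" where
  "domination_number G = (LEAST n. \<exists>D. dominating_set G D \<and> finite D \<and> card D = n)"

end

theory Submission
  imports Defs "HOL-Algebra.QuotRing"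
begin

text \<open>
  Over a finite field \<open>F\<close> in which \<open>2 \<noteq> 0\<close> there are \<open>\<alpha>\<close>, \<open>\<beta>\<close> with \<open>\<alpha>\<^sup>2 + \<beta>\<^sup>2 = -1\<close>,
  and they split the quaternions: the quaternion ring is isomorphic to the ring of two by two
  matrices over \<open>F\<close> (lemma \<open>quat_to_mat2_ring_iso\<close>).  So the question is one about matrices.

  The nonzero zero divisors among the matrices are those of rank one.  Such a matrix \<open>M\<close> has two
  lines of the plane attached to it, its kernel and its image, and \<open>M N = 0\<close> means exactly that
  the image of \<open>N\<close> is the kernel of \<open>M\<close>.  Adjacency therefore depends on the two lines only.
  There are \<open>|F| + 1\<close> lines.  Every pair of lines is the kernel and image of some \<open>M\<close>, and then
  also of \<open>-M \<noteq> M\<close>.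

  The rest is combinatorics (lemma \<open>domination_number_two_labels\<close>).  One matrix for each kernel line
  gives a dominating set of size \<open>|F| + 1\<close>.  In a smaller dominating set \<open>D\<close>, some lines are missing
  among the kernels, and some among the images.  The matrices whose image is a missing kernel and
  whose kernel is a missing image have no neighbour in \<open>D\<close>, so all of them belong to \<open>D\<close>.  As each
  such pair of lines comes from at least two matrices, \<open>D\<close> repeats too many kernels to be small.
\<close>


section \<open>Domination in graphs with two labels\<close>

text \<open>For the lower bound let \<open>A\<close> and \<open>B\<close> be the labels that \<open>K\<close> and \<open>I\<close> do not take on a dominating
  set \<open>D\<close>.  A vertex \<open>x\<close> with \<open>K x \<in> B\<close> and \<open>I x \<in> A\<close> has no neighbour in \<open>D\<close>, hence lies in \<open>D\<close>.
  Call \<open>E\<close> the set of these \<open>x\<close>; it has at least \<open>2|A||B|\<close> elements but contributes at most \<open>|B|\<close>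
  values of \<open>K\<close>.  Counting the values of \<open>K\<close> on \<open>D\<close> gives \<open>|L| - |A| \<le> |B| + |D| - 2|A||B|\<close>, and
  \<open>|A| + |B| \<le> 2|A||B|\<close> as soon as both sets are nonempty.\<close>

lemma domination_number_two_labels:
  fixes G :: "'a pair_pre_digraph" and K I :: "'a \<Rightarrow> 'l"
  assumes L: "finite L"
    and KL: "K ` pverts G \<subseteq> L" and IL: "I ` pverts G \<subseteq> L"
    and two: "\<And>k i. k \<in> L \<Longrightarrow> i \<in> L \<Longrightarrow>
      \<exists>x\<in>pverts G. \<exists>y\<in>pverts G. x \<noteq> y \<and> K x = k \<and> I x = i \<and> K y = k \<and> I y = i"
    and arcs: "\<And>u v. u \<in> pverts G \<Longrightarrow> v \<in> pverts G \<Longrightarrow>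
      (u, v) \<in> parcs G \<longleftrightarrow> u \<noteq> v \<and> (K u = I v \<or> K v = I u)"
  shows "domination_number G = card L"
  unfolding domination_number_def
proof (rule Least_equality)
  obtain s where s: "\<And>k. k \<in> L \<Longrightarrow> s k \<in> pverts G \<and> K (s k) = k"
  proof -
    have "\<forall>k\<in>L. \<exists>x. x \<in> pverts G \<and> K x = k" using two by blast
    from bchoice[OF this] show thesis using that by blast
  qed
  \<comment> \<open>One vertex for each value of \<open>K\<close>: any other \<open>v\<close> is adjacent to the one with \<open>K\<close>-value \<open>I v\<close>.\<close>
  have "inj_on s L" using s by (intro inj_on_inverseI[of _ K]) simp
  moreover have "dominating_set G (s ` L)" unfolding dominating_set_def
  proof (intro conjI ballI)
    show "s ` L \<subseteq> pverts G" using s by blast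
    fix v assume v: "v \<in> pverts G - s ` L"
    then have "I v \<in> L" using IL by blast
    then have "s (I v) \<noteq> v" "s (I v) \<in> pverts G" "K (s (I v)) = I v"
      using s[of "I v"] v by (auto intro: rev_image_eqI)
    with v \<open>I v \<in> L\<close> show "\<exists>u\<in>s ` L. (u, v) \<in> parcs G" using arcs by blast
  qed
  ultimately show "\<exists>D. dominating_set G D \<and> finite D \<and> card D = card L"
    using L by (auto intro!: exI[of _ "s ` L"] simp: card_image)
next
  fix n assume "\<exists>D. dominating_set G D \<and> finite D \<and> card D = n"
  then obtain D where D: "dominating_set G D" "finite D" and n: "n = card D" by auto
  have sub: "D \<subseteq> pverts G" using D(1) by (simp add: dominating_set_def)
  define A B where "A = L - K ` D" and "B = L - I ` D"
  have fin: "finite A" "finite B" using L by (auto simp: A_def B_def)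
  have "K ` D \<subseteq> L" "I ` D \<subseteq> L" using sub KL IL by auto
  then have card_L: "card L = card (K ` D) + card A" "card L = card (I ` D) + card B"
    using L D(2) by (simp_all add: A_def B_def card_Diff_subset card_mono)
  show "card L \<le> n"
  proof (cases "A = {} \<or> B = {}")
    case True
    then show ?thesis
      using card_L card_image_le[OF D(2), of K] card_image_le[OF D(2), of I] n by auto
  next
    case False
    define E where "E = {x \<in> D. K x \<in> B \<and> I x \<in> A}"
    have in_D: "x \<in> E" if "x \<in> pverts G" "K x \<in> B" "I x \<in> A" for x
    proof -
      have "x \<in> D"
      proof (rule ccontr)
        assume "x \<notin> D"
        then obtain u where "u \<in> D" "(u, x) \<in> parcs G"
          using D(1) \<open>x \<in> pverts G\<close> unfolding dominating_set_def by blast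
        then have "K u = I x \<or> K x = I u" using arcs that sub by blast
        moreover have "K u \<in> K ` D" "I u \<in> I ` D" using \<open>u \<in> D\<close> by auto
        ultimately show False using that by (simp add: A_def B_def) metis
      qed
      then show ?thesis using that by (simp add: E_def)
    qed
    \<comment> \<open>The fibres of the pair of labels partition \<open>E\<close>, and each has two elements at least.\<close>
    define F where "F p = {x \<in> E. (K x, I x) = p}" for p
    have finE: "finite E" using D(2) by (simp add: E_def)
    have "2 \<le> card (F p)" if "p \<in> B \<times> A" for p
    proof -
      obtain k i where p: "p = (k, i)" "k \<in> B" "i \<in> A" using \<open>p \<in> B \<times> A\<close> by auto
      then obtain x y where xy: "x \<in> pverts G" "y \<in> pverts G" "x \<noteq> y"
        "K x = k" "I x = i" "K y = k" "I y = i"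
        using two[of k i] by (auto simp: A_def B_def)
      then have "{x, y} \<subseteq> F p" using in_D p by (auto simp: F_def)
      moreover have "finite (F p)" using finE by (simp add: F_def)
      ultimately show ?thesis using xy(3) card_mono[of "F p" "{x, y}"] by simp
    qed
    then have "card (B \<times> A) * 2 \<le> (\<Sum>p\<in>B \<times> A. card (F p))"
      using sum_bounded_below[of "B \<times> A" 2 "\<lambda>p. card (F p)"] by simp
    also have "\<dots> = card (\<Union>p\<in>B \<times> A. F p)"
      using fin finE by (subst card_UN_disjoint) (auto simp: F_def)
    also have "\<dots> \<le> card E" using finE by (intro card_mono) (auto simp: F_def)
    finally have E: "2 * (card B * card A) \<le> card E" by (simp add: card_cartesian_product)
    have "K ` D \<subseteq> B \<union> K ` (D - E)" by (auto simp: E_def)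
    then have "card (K ` D) \<le> card (B \<union> K ` (D - E))" using fin D(2) by (intro card_mono) auto
    also have "\<dots> \<le> card B + card (D - E)"
      using card_Un_le[of B "K ` (D - E)"] card_image_le[of "D - E" K] D(2) by simp
    also have "card (D - E) = card D - card E"
      using finE by (intro card_Diff_subset) (auto simp: E_def)
    finally have KD: "card (K ` D) \<le> card B + (card D - card E)" .
    have "card E \<le> card D" using D(2) by (intro card_mono) (auto simp: E_def)
    moreover have "card A \<le> card B * card A" "card B \<le> card B * card A"
      using False fin by (simp_all add: Suc_le_eq card_gt_0_iff)
    ultimately show ?thesis using KD E card_L(1) n by linarith
  qed
qed


section \<open>Lines in the plane over a field\<close>

text \<open>The determinant of the matrix with columns \<open>u\<close> and \<open>v\<close>: it vanishes iff \<open>u\<close> and \<open>v\<close> are parallel.\<close>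

definition cross :: "('a, 'm) ring_scheme \<Rightarrow> 'a \<times> 'a \<Rightarrow> 'a \<times> 'a \<Rightarrow> 'a" where
  "cross R u v = fst u \<otimes>\<^bsub>R\<^esub> snd v \<ominus>\<^bsub>R\<^esub> snd u \<otimes>\<^bsub>R\<^esub> fst v"

definition nonzero_vectors :: "('a, 'm) ring_scheme \<Rightarrow> ('a \<times> 'a) set" where
  "nonzero_vectors R = carrier R \<times> carrier R - {(\<zero>\<^bsub>R\<^esub>, \<zero>\<^bsub>R\<^esub>)}"

text \<open>Describing the line through \<open>u\<close> by an equation instead of by multiples of \<open>u\<close> avoids existential
  quantifiers over scalars: equality of lines becomes transitivity of being parallel.  This is the
  intended object for nonzero \<open>u\<close> only.\<close>

definition line :: "('a, 'm) ring_scheme \<Rightarrow> 'a \<times> 'a \<Rightarrow> ('a \<times> 'a) set" where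
  "line R u = {w \<in> carrier R \<times> carrier R. cross R u w = \<zero>\<^bsub>R\<^esub>}"

context field
begin

lemma neg_eq_zero_iff: "s \<in> carrier R \<Longrightarrow> \<ominus> s = \<zero> \<longleftrightarrow> s = \<zero>"
  by (metis minus_minus minus_zero)

lemma scaled_pair_zero_iff:
  assumes "u \<in> nonzero_vectors R" and "x \<in> carrier R"
  shows "fst u \<otimes> x = \<zero> \<and> snd u \<otimes> x = \<zero> \<longleftrightarrow> x = \<zero>"
  using assms by (auto simp: nonzero_vectors_def integral_iff)

lemma cross_closed:
  "u \<in> carrier R \<times> carrier R \<Longrightarrow> v \<in> carrier R \<times> carrier R \<Longrightarrow> cross R u v \<in> carrier R"
  by (auto simp: cross_def)

text \<open>The vectors \<open>u\<close>, \<open>v\<close>, \<open>w\<close> of the plane satisfy \<open>u (v \<times> w) = v (u \<times> w) - w (u \<times> v)\<close>, where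
  \<open>\<times>\<close> is \<open>cross\<close>.\<close>

lemma parallel_trans:
  assumes "u \<in> nonzero_vectors R" and "v \<in> carrier R \<times> carrier R" and "w \<in> carrier R \<times> carrier R"
    and "cross R u v = \<zero>" and "cross R u w = \<zero>"
  shows "cross R v w = \<zero>"
proof -
  obtain u1 u2 v1 v2 w1 w2 where uvw: "u = (u1, u2)" "v = (v1, v2)" "w = (w1, w2)"
    and c: "u1 \<in> carrier R" "u2 \<in> carrier R" "v1 \<in> carrier R" "v2 \<in> carrier R"
      "w1 \<in> carrier R" "w2 \<in> carrier R"
    using assms(1-3) unfolding nonzero_vectors_def by blast
  have "u1 \<otimes> cross R v w = v1 \<otimes> cross R u w \<ominus> w1 \<otimes> cross R u v"
    "u2 \<otimes> cross R v w = v2 \<otimes> cross R u w \<ominus> w2 \<otimes> cross R u v"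
    using c unfolding uvw cross_def fst_conv snd_conv by algebra+
  then have "fst u \<otimes> cross R v w = \<zero> \<and> snd u \<otimes> cross R v w = \<zero>"
    using c assms(4,5) by (simp add: uvw minus_eq)
  then show ?thesis using scaled_pair_zero_iff[OF assms(1)] cross_closed assms by blast
qed

lemma cross_commute_zero:
  assumes "u \<in> carrier R \<times> carrier R" "v \<in> carrier R \<times> carrier R" "cross R u v = \<zero>"
  shows "cross R v u = \<zero>"
  using assms by (auto simp: cross_def m_comm)

lemma line_eq_iff:
  assumes u: "u \<in> nonzero_vectors R" and v: "v \<in> nonzero_vectors R"
  shows "line R u = line R v \<longleftrightarrow> cross R u v = \<zero>"
proof
  have c: "u \<in> carrier R \<times> carrier R" "v \<in> carrier R \<times> carrier R"
    using u v by (auto simp: nonzero_vectors_def)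
  {
    assume "line R u = line R v"
    moreover have "v \<in> line R v" using c by (auto simp: line_def cross_def m_comm minus_eq r_neg)
    ultimately have "v \<in> line R u" by simp
    then show "cross R u v = \<zero>" by (simp add: line_def)
  next
    assume uv: "cross R u v = \<zero>"
    then have vu: "cross R v u = \<zero>" using c cross_commute_zero by blast
    show "line R u = line R v"
      using parallel_trans[OF u c(2) _ uv] parallel_trans[OF v c(1) _ vu]
      by (auto simp: line_def)
  }
qed

text \<open>Each line passes through exactly one of the points \<open>(1, s)\<close> and \<open>(0, 1)\<close>.\<close>

lemma card_lines:
  assumes fin: "finite (carrier R)"
  shows "card (line R ` nonzero_vectors R) = card (carrier R) + 1"
proof -
  define P where "P = insert (\<zero>, \<one>) ((\<lambda>s. (\<one>, s)) ` carrier R)"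
  have P: "P \<subseteq> nonzero_vectors R" by (auto simp: P_def nonzero_vectors_def)
  have "line R ` nonzero_vectors R = line R ` P"
  proof
    show "line R ` P \<subseteq> line R ` nonzero_vectors R" using P by blast
    show "line R ` nonzero_vectors R \<subseteq> line R ` P"
    proof
      fix l assume "l \<in> line R ` nonzero_vectors R"
      then obtain u1 u2 where l: "l = line R (u1, u2)" and u: "(u1, u2) \<in> nonzero_vectors R"
        and c: "u1 \<in> carrier R" "u2 \<in> carrier R"
        by (auto simp: nonzero_vectors_def)
      obtain q where q: "q \<in> P" "cross R (u1, u2) q = \<zero>"
      proof (cases "u1 = \<zero>")
        case True
        then show thesis using c that[of "(\<zero>, \<one>)"] by (simp add: P_def cross_def)
      next
        case False
        then have i: "inv u1 \<in> carrier R" "u1 \<otimes> inv u1 = \<one>"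
          using c by (simp_all add: field_Units)
        have "u1 \<otimes> (inv u1 \<otimes> u2) = u2" using i c by (simp flip: m_assoc)
        then show thesis using c i that[of "(\<one>, inv u1 \<otimes> u2)"] by (simp add: P_def cross_def)
      qed
      then have "l = line R q" using l u P line_eq_iff by blast
      then show "l \<in> line R ` P" using q by blast
    qed
  qed
  moreover have "inj_on (line R) P"
  proof (rule inj_onI)
    fix q r assume qr: "q \<in> P" "r \<in> P" "line R q = line R r"
    then have "cross R q r = \<zero>" using line_eq_iff P by blast
    then show "q = r" using qr(1,2) by (auto simp: P_def cross_def)
  qed
  moreover have "card P = card (carrier R) + 1"
    using fin by (simp add: P_def card_insert_if card_image inj_on_def image_iff)
  ultimately show ?thesis by (simp add: card_image)
qed

end


section \<open>The zero divisor graph of the two by two matrices\<close>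

text \<open>The tuple \<open>(a, b, c, d)\<close> is the matrix with rows \<open>(a, b)\<close> and \<open>(c, d)\<close>.\<close>

definition mat2_ring :: "('a, 'm) ring_scheme \<Rightarrow> 'a quat ring" where
  "mat2_ring R =
    \<lparr>carrier = carrier R \<times> carrier R \<times> carrier R \<times> carrier R,
     monoid.mult = (\<lambda>(a, b, c, d) (a', b', c', d').
       (a \<otimes>\<^bsub>R\<^esub> a' \<oplus>\<^bsub>R\<^esub> b \<otimes>\<^bsub>R\<^esub> c', a \<otimes>\<^bsub>R\<^esub> b' \<oplus>\<^bsub>R\<^esub> b \<otimes>\<^bsub>R\<^esub> d',
        c \<otimes>\<^bsub>R\<^esub> a' \<oplus>\<^bsub>R\<^esub> d \<otimes>\<^bsub>R\<^esub> c', c \<otimes>\<^bsub>R\<^esub> b' \<oplus>\<^bsub>R\<^esub> d \<otimes>\<^bsub>R\<^esub> d')),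
     one = (\<one>\<^bsub>R\<^esub>, \<zero>\<^bsub>R\<^esub>, \<zero>\<^bsub>R\<^esub>, \<one>\<^bsub>R\<^esub>),
     zero = (\<zero>\<^bsub>R\<^esub>, \<zero>\<^bsub>R\<^esub>, \<zero>\<^bsub>R\<^esub>, \<zero>\<^bsub>R\<^esub>),
     add = (\<lambda>(a, b, c, d) (a', b', c', d').
       (a \<oplus>\<^bsub>R\<^esub> a', b \<oplus>\<^bsub>R\<^esub> b', c \<oplus>\<^bsub>R\<^esub> c', d \<oplus>\<^bsub>R\<^esub> d'))\<rparr>"

lemma (in cring) ring_mat2_ring: "ring (mat2_ring R)"
proof (intro ringI abelian_groupI monoidI)
  fix x assume "x \<in> carrier (mat2_ring R)"
  then obtain a b c d where x: "x = (a, b, c, d)"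
    and abcd: "a \<in> carrier R" "b \<in> carrier R" "c \<in> carrier R" "d \<in> carrier R"
    by (auto simp: mat2_ring_def)
  then show "\<exists>y\<in>carrier (mat2_ring R). y \<oplus>\<^bsub>mat2_ring R\<^esub> x = \<zero>\<^bsub>mat2_ring R\<^esub>"
    by (intro bexI[of _ "(\<ominus> a, \<ominus> b, \<ominus> c, \<ominus> d)"]) (auto simp: mat2_ring_def l_neg)
qed (auto simp: mat2_ring_def l_distr r_distr m_ac a_ac)

fun mat2_kernel :: "('a, 'm) ring_scheme \<Rightarrow> 'a quat \<Rightarrow> ('a \<times> 'a) set" where
  "mat2_kernel R (a, b, c, d) = {(x, y) \<in> carrier R \<times> carrier R.
     a \<otimes>\<^bsub>R\<^esub> x \<oplus>\<^bsub>R\<^esub> b \<otimes>\<^bsub>R\<^esub> y = \<zero>\<^bsub>R\<^esub> \<and> c \<otimes>\<^bsub>R\<^esub> x \<oplus>\<^bsub>R\<^esub> d \<otimes>\<^bsub>R\<^esub> y = \<zero>\<^bsub>R\<^esub>}"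

text \<open>For a matrix of rank one this is the image: the line of all vectors parallel to every column.
  (A zero column imposes no condition.)\<close>

fun mat2_image :: "('a, 'm) ring_scheme \<Rightarrow> 'a quat \<Rightarrow> ('a \<times> 'a) set" where
  "mat2_image R (a, b, c, d) = line R (a, c) \<inter> line R (b, d)"

text \<open>The linear map \<open>x \<mapsto> (v \<times> x) u\<close>, where \<open>\<times>\<close> is \<open>cross\<close>.  This form of the rank-one matrices has the
  advantage that \<open>u\<close> spans the image and \<open>v\<close> itself spans the kernel.\<close>

fun outer :: "('a, 'm) ring_scheme \<Rightarrow> 'a \<times> 'a \<Rightarrow> 'a \<times> 'a \<Rightarrow> 'a quat" where
  "outer R (u1, u2) (v1, v2) = (\<ominus>\<^bsub>R\<^esub> (u1 \<otimes>\<^bsub>R\<^esub> v2), u1 \<otimes>\<^bsub>R\<^esub> v1, \<ominus>\<^bsub>R\<^esub> (u2 \<otimes>\<^bsub>R\<^esub> v2), u2 \<otimes>\<^bsub>R\<^esub> v1)"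

context field
begin

lemma mat2_kernel_outer:
  assumes "u \<in> nonzero_vectors R" and "v \<in> nonzero_vectors R"
  shows "mat2_kernel R (outer R u v) = line R v"
proof -
  obtain u1 u2 v1 v2 where uv: "u = (u1, u2)" "v = (v1, v2)"
    and c: "u1 \<in> carrier R" "u2 \<in> carrier R" "v1 \<in> carrier R" "v2 \<in> carrier R"
    using assms by (auto simp: nonzero_vectors_def)
  have row: "\<ominus> (s \<otimes> v2) \<otimes> x \<oplus> s \<otimes> v1 \<otimes> y = s \<otimes> cross R v (x, y)"
    if "s \<in> carrier R" "x \<in> carrier R" "y \<in> carrier R" for s x y
    using c that unfolding uv cross_def fst_conv snd_conv by algebra
  have "(x, y) \<in> mat2_kernel R (outer R u v) \<longleftrightarrow> (x, y) \<in> line R v" for x y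
  proof (cases "x \<in> carrier R \<and> y \<in> carrier R")
    case True
    then have "cross R v (x, y) \<in> carrier R" using c by (intro cross_closed) (auto simp: uv)
    from scaled_pair_zero_iff[OF assms(1) this] True c show ?thesis
      by (simp add: uv(1) uv(2)[symmetric] line_def) (simp add: uv row)
  qed (auto simp: uv line_def)
  then show ?thesis by auto
qed

lemma mat2_image_outer:
  assumes "u \<in> nonzero_vectors R" and "v \<in> nonzero_vectors R"
  shows "mat2_image R (outer R u v) = line R u"
proof -
  obtain u1 u2 v1 v2 where uv: "u = (u1, u2)" "v = (v1, v2)"
    and c: "u1 \<in> carrier R" "u2 \<in> carrier R" "v1 \<in> carrier R" "v2 \<in> carrier R"
    using assms by (auto simp: nonzero_vectors_def)
  have columns: "cross R (u1 \<otimes> v1, u2 \<otimes> v1) w = v1 \<otimes> cross R u w"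
    "cross R (\<ominus> (u1 \<otimes> v2), \<ominus> (u2 \<otimes> v2)) w = \<ominus> (v2 \<otimes> cross R u w)"
    if "w \<in> carrier R \<times> carrier R" for w
  proof -
    obtain x y where w: "w = (x, y)" "x \<in> carrier R" "y \<in> carrier R" using \<open>w \<in> carrier R \<times> carrier R\<close> by blast
    show "cross R (u1 \<otimes> v1, u2 \<otimes> v1) w = v1 \<otimes> cross R u w"
      "cross R (\<ominus> (u1 \<otimes> v2), \<ominus> (u2 \<otimes> v2)) w = \<ominus> (v2 \<otimes> cross R u w)"
      using c w(2,3) unfolding uv w(1) cross_def fst_conv snd_conv by algebra+
  qed
  have "w \<in> mat2_image R (outer R u v) \<longleftrightarrow> w \<in> line R u" for w
  proof (cases "w \<in> carrier R \<times> carrier R")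
    case True
    then have k: "cross R u w \<in> carrier R" using c by (intro cross_closed) (auto simp: uv)
    have "w \<in> mat2_image R (outer R u v) \<longleftrightarrow> v2 \<otimes> cross R u w = \<zero> \<and> v1 \<otimes> cross R u w = \<zero>"
      using True c k columns[OF True] by (simp add: uv line_def neg_eq_zero_iff)
    also have "\<dots> \<longleftrightarrow> w \<in> line R u"
      using scaled_pair_zero_iff[OF assms(2) k] True by (auto simp: uv(2) line_def)
    finally show ?thesis .
  qed (simp add: uv line_def)
  then show ?thesis by auto
qed

lemma outer_nonzero:
  assumes "u \<in> nonzero_vectors R" and "v \<in> nonzero_vectors R"
  shows "outer R u v \<noteq> \<zero>\<^bsub>mat2_ring R\<^esub>"
proof
  assume zero: "outer R u v = \<zero>\<^bsub>mat2_ring R\<^esub>"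
  obtain u1 u2 v1 v2 where uv: "u = (u1, u2)" "v = (v1, v2)"
    and c: "u1 \<in> carrier R" "u2 \<in> carrier R" "v1 \<in> carrier R" "v2 \<in> carrier R"
    and nz: "u1 \<noteq> \<zero> \<or> u2 \<noteq> \<zero>" "v1 \<noteq> \<zero> \<or> v2 \<noteq> \<zero>"
    using assms by (auto simp: nonzero_vectors_def)
  have "\<ominus> (\<ominus> (u1 \<otimes> v2)) = \<zero>" "\<ominus> (\<ominus> (u2 \<otimes> v2)) = \<zero>" "u1 \<otimes> v1 = \<zero>" "u2 \<otimes> v1 = \<zero>"
    using zero by (simp_all add: uv mat2_ring_def)
  then show False using c nz by (simp add: integral_iff) metis
qed

lemma outer_closed:
  assumes "u \<in> nonzero_vectors R" and "v \<in> nonzero_vectors R"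
  shows "outer R u v \<in> carrier (mat2_ring R)"
  using assms by (auto simp: nonzero_vectors_def mat2_ring_def)

text \<open>The composition of \<open>x \<mapsto> (v \<times> x) u\<close> after \<open>x \<mapsto> (v' \<times> x) u'\<close> is \<open>x \<mapsto> (v \<times> u') (v' \<times> x) u\<close>, a
  multiple of the nonzero map \<open>outer R u v'\<close> by the scalar \<open>v \<times> u'\<close>.\<close>

lemma outer_mult_zero_iff:
  assumes "u \<in> nonzero_vectors R" "v \<in> nonzero_vectors R"
    and "u' \<in> nonzero_vectors R" "v' \<in> nonzero_vectors R"
  shows "outer R u v \<otimes>\<^bsub>mat2_ring R\<^esub> outer R u' v' = \<zero>\<^bsub>mat2_ring R\<^esub> \<longleftrightarrow> cross R v u' = \<zero>"
proof -
  obtain u1 u2 v1 v2 where uv: "u = (u1, u2)" "v = (v1, v2)"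
    and c: "u1 \<in> carrier R" "u2 \<in> carrier R" "v1 \<in> carrier R" "v2 \<in> carrier R"
    using assms(1,2) by (auto simp: nonzero_vectors_def)
  obtain x1 x2 y1 y2 where xy: "u' = (x1, x2)" "v' = (y1, y2)"
    and c': "x1 \<in> carrier R" "x2 \<in> carrier R" "y1 \<in> carrier R" "y2 \<in> carrier R"
    using assms(3,4) by (auto simp: nonzero_vectors_def)
  let ?k = "cross R v u'"
  have k: "?k \<in> carrier R" using c c' by (simp add: uv xy cross_def)
  have entry: "\<ominus> (s \<otimes> v2) \<otimes> (x1 \<otimes> r) \<oplus> s \<otimes> v1 \<otimes> (x2 \<otimes> r) = ?k \<otimes> (s \<otimes> r)"
    "\<ominus> (s \<otimes> v2) \<otimes> \<ominus> (x1 \<otimes> r) \<oplus> s \<otimes> v1 \<otimes> \<ominus> (x2 \<otimes> r) = ?k \<otimes> \<ominus> (s \<otimes> r)"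
    if "s \<in> carrier R" "r \<in> carrier R" for s r
    using c c' that unfolding uv xy cross_def fst_conv snd_conv by algebra+
  have prod: "outer R u v \<otimes>\<^bsub>mat2_ring R\<^esub> outer R u' v' =
    (?k \<otimes> \<ominus> (u1 \<otimes> y2), ?k \<otimes> (u1 \<otimes> y1), ?k \<otimes> \<ominus> (u2 \<otimes> y2), ?k \<otimes> (u2 \<otimes> y1))"
    using c c' entry by (simp add: uv(1) uv(2)[symmetric] xy(1)[symmetric] mat2_ring_def)
      (simp add: uv xy)
  have "(u1, u2) \<in> nonzero_vectors R" "(y1, y2) \<in> nonzero_vectors R"
    using assms uv xy by auto
  from outer_nonzero[OF this] show ?thesis
    using k c c' unfolding prod by (auto simp: mat2_ring_def integral_iff)
qed

text \<open>If the first column is nonzero, the second is a multiple of it by some \<open>s\<close>, and the matrix is the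
  column \<open>(a, c)\<close> times the row \<open>(1, s)\<close>, which is \<open>outer\<close> with \<open>v = (s, -1)\<close>.\<close>

lemma singular_eq_outer:
  assumes c: "a \<in> carrier R" "b \<in> carrier R" "c \<in> carrier R" "d \<in> carrier R"
    and det: "a \<otimes> d = b \<otimes> c" and nonzero: "(a, b, c, d) \<noteq> (\<zero>, \<zero>, \<zero>, \<zero>)"
  shows "\<exists>u\<in>nonzero_vectors R. \<exists>v\<in>nonzero_vectors R. (a, b, c, d) = outer R u v"
proof (cases "a = \<zero> \<and> c = \<zero>")
  case True
  then show ?thesis
    using c nonzero
    by (intro bexI[of _ "(b, d)"] bexI[of _ "(\<one>, \<zero>)"]) (auto simp: nonzero_vectors_def)
next
  case False
  obtain s where s: "s \<in> carrier R" "b = a \<otimes> s" "d = c \<otimes> s"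
  proof (cases "a = \<zero>")
    case True
    then have "c \<noteq> \<zero>" using False by simp
    then have i: "inv c \<in> carrier R" "c \<otimes> inv c = \<one>" using c by (simp_all add: field_Units)
    have "b \<otimes> c = \<zero>" using det True c(4) by simp
    then have "b = \<zero>" using \<open>c \<noteq> \<zero>\<close> c by (simp add: integral_iff)
    moreover have "c \<otimes> (inv c \<otimes> d) = d" using i c by (simp flip: m_assoc)
    ultimately show thesis using True c i that[of "inv c \<otimes> d"] by simp
  next
    case False
    then have i: "inv a \<in> carrier R" "a \<otimes> inv a = \<one>" using c by (simp_all add: field_Units)
    have "a \<otimes> (inv a \<otimes> b) = b" using i c by (simp flip: m_assoc)
    moreover have "c \<otimes> (inv a \<otimes> b) = d"
    proof -
      have "c \<otimes> (inv a \<otimes> b) = inv a \<otimes> (b \<otimes> c)" using i(1) c by (simp add: m_ac)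
      also have "\<dots> = a \<otimes> inv a \<otimes> d" using i(1) c by (simp add: m_ac flip: det)
      finally show ?thesis using i c by simp
    qed
    ultimately show thesis using c i that[of "inv a \<otimes> b"] by simp
  qed
  have "(a, c) \<in> nonzero_vectors R" using False c by (auto simp: nonzero_vectors_def)
  moreover have "(s, \<ominus> \<one>) \<in> nonzero_vectors R"
    using s by (simp add: nonzero_vectors_def neg_eq_zero_iff)
  moreover have "(a, b, c, d) = outer R (a, c) (s, \<ominus> \<one>)" using s c by (simp add: r_minus)
  ultimately show ?thesis by blast
qed

text \<open>Cramer's rule: the determinant annihilates every solution of the homogeneous system.\<close>

lemma singular_if_kills:
  assumes "a \<in> carrier R" "b \<in> carrier R" "c \<in> carrier R" "d \<in> carrier R"
    and "x \<in> carrier R" "y \<in> carrier R"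
    and "a \<otimes> x \<oplus> b \<otimes> y = \<zero>" "c \<otimes> x \<oplus> d \<otimes> y = \<zero>" and "x \<noteq> \<zero> \<or> y \<noteq> \<zero>"
  shows "a \<otimes> d = b \<otimes> c"
proof -
  have "(a \<otimes> d \<ominus> b \<otimes> c) \<otimes> x = d \<otimes> (a \<otimes> x \<oplus> b \<otimes> y) \<ominus> b \<otimes> (c \<otimes> x \<oplus> d \<otimes> y)"
    "(a \<otimes> d \<ominus> b \<otimes> c) \<otimes> y = a \<otimes> (c \<otimes> x \<oplus> d \<otimes> y) \<ominus> c \<otimes> (a \<otimes> x \<oplus> b \<otimes> y)"
    using assms(1-6) by algebra+
  then have "(a \<otimes> d \<ominus> b \<otimes> c) \<otimes> x = \<zero>" "(a \<otimes> d \<ominus> b \<otimes> c) \<otimes> y = \<zero>"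
    using assms(1-6) unfolding assms(7,8) by (simp_all add: minus_eq)
  then have "a \<otimes> d \<ominus> b \<otimes> c = \<zero>" using assms(1-6,9) by (auto simp: integral_iff simp del: r_right_minus_eq)
  then show ?thesis using assms(1-6) by simp
qed

text \<open>If \<open>M N = 0\<close> with \<open>N \<noteq> 0\<close>, then \<open>M\<close> kills a nonzero column of \<open>N\<close>; if \<open>N M = 0\<close>, then the transpose
  of \<open>M\<close> kills a nonzero row of \<open>N\<close>.  Either way \<open>M\<close> is singular.  Conversely \<open>outer R u v\<close> maps \<open>v\<close>
  to zero, hence \<open>outer R u v\<close> times \<open>outer R v v\<close> is zero.\<close>

lemma nonzero_zero_divisors_mat2_ring:
  "zero_divisors (mat2_ring R) - {\<zero>\<^bsub>mat2_ring R\<^esub>} =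
    {outer R u v | u v. u \<in> nonzero_vectors R \<and> v \<in> nonzero_vectors R}"
proof (intro equalityI subsetI)
  fix M assume "M \<in> {outer R u v | u v. u \<in> nonzero_vectors R \<and> v \<in> nonzero_vectors R}"
  then obtain u v where M: "M = outer R u v" and uv: "u \<in> nonzero_vectors R" "v \<in> nonzero_vectors R"
    by blast
  have "cross R v v = \<zero>" using uv(2) by (auto simp: nonzero_vectors_def cross_def m_comm minus_eq r_neg)
  then have "M \<otimes>\<^bsub>mat2_ring R\<^esub> outer R v v = \<zero>\<^bsub>mat2_ring R\<^esub>" using outer_mult_zero_iff uv M by simp
  then show "M \<in> zero_divisors (mat2_ring R) - {\<zero>\<^bsub>mat2_ring R\<^esub>}"
    using uv outer_nonzero outer_closed unfolding zero_divisors_def M by blast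
next
  fix M assume M: "M \<in> zero_divisors (mat2_ring R) - {\<zero>\<^bsub>mat2_ring R\<^esub>}"
  then obtain N where N: "N \<in> carrier (mat2_ring R)" "N \<noteq> \<zero>\<^bsub>mat2_ring R\<^esub>"
    "M \<otimes>\<^bsub>mat2_ring R\<^esub> N = \<zero>\<^bsub>mat2_ring R\<^esub> \<or> N \<otimes>\<^bsub>mat2_ring R\<^esub> M = \<zero>\<^bsub>mat2_ring R\<^esub>"
    by (auto simp: zero_divisors_def)
  obtain a b c d where abcd: "M = (a, b, c, d)" "a \<in> carrier R" "b \<in> carrier R" "c \<in> carrier R"
    "d \<in> carrier R" and nz: "(a, b, c, d) \<noteq> (\<zero>, \<zero>, \<zero>, \<zero>)"
    using M by (auto simp: zero_divisors_def mat2_ring_def)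
  obtain p q r s where pqrs: "N = (p, q, r, s)" "p \<in> carrier R" "q \<in> carrier R" "r \<in> carrier R"
    "s \<in> carrier R" and nz': "(p \<noteq> \<zero> \<or> r \<noteq> \<zero>) \<or> (q \<noteq> \<zero> \<or> s \<noteq> \<zero>)"
    using N(1,2) by (auto simp: mat2_ring_def)
  note sing = singular_if_kills[OF abcd(2-5)]
  note sing' = singular_if_kills[OF abcd(2,4,3,5)]
  from N(3) have "a \<otimes> d = b \<otimes> c"
  proof
    assume "M \<otimes>\<^bsub>mat2_ring R\<^esub> N = \<zero>\<^bsub>mat2_ring R\<^esub>"
    then show ?thesis
      using sing[of p r] sing[of q s] nz' pqrs(2-5) by (auto simp: abcd(1) pqrs(1) mat2_ring_def)
  next
    assume "N \<otimes>\<^bsub>mat2_ring R\<^esub> M = \<zero>\<^bsub>mat2_ring R\<^esub>"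
    then have "a \<otimes> p \<oplus> c \<otimes> q = \<zero>" "b \<otimes> p \<oplus> d \<otimes> q = \<zero>" "a \<otimes> r \<oplus> c \<otimes> s = \<zero>" "b \<otimes> r \<oplus> d \<otimes> s = \<zero>"
      using abcd(2-5) pqrs(2-5) by (simp_all add: abcd(1) pqrs(1) mat2_ring_def m_comm)
    then show ?thesis
      using sing'[of p q] sing'[of r s] nz' pqrs(2-5) abcd(2-5) m_comm[of b c] by auto
  qed
  then show "M \<in> {outer R u v | u v. u \<in> nonzero_vectors R \<and> v \<in> nonzero_vectors R}"
    using singular_eq_outer[OF abcd(2-5) _ nz] abcd(1) by blast
qed

theorem domination_number_mat2_ring:
  assumes fin: "finite (carrier R)" and char: "\<one> \<oplus> \<one> \<noteq> \<zero>"
  shows "domination_number (zero_divisor_graph (mat2_ring R)) = card (carrier R) + 1"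
proof -
  let ?G = "zero_divisor_graph (mat2_ring R)"
  let ?V = "nonzero_vectors R"
  have finV: "finite ?V" using fin by (simp add: nonzero_vectors_def)
  have verts: "pverts ?G = {outer R u v | u v. u \<in> ?V \<and> v \<in> ?V}"
    by (simp add: zero_divisor_graph_def nonzero_zero_divisors_mat2_ring)
  have "domination_number ?G = card (line R ` ?V)"
  proof (rule domination_number_two_labels[where K = "mat2_kernel R" and I = "mat2_image R"])
    show "finite (line R ` ?V)" using finV by simp
    show "mat2_kernel R ` pverts ?G \<subseteq> line R ` ?V" "mat2_image R ` pverts ?G \<subseteq> line R ` ?V"
      using mat2_kernel_outer mat2_image_outer by (auto simp: verts)
  next
    fix k i assume "k \<in> line R ` ?V" "i \<in> line R ` ?V"
    then obtain u v where u: "u \<in> ?V" "i = line R u" and v: "v \<in> ?V" "k = line R v" by blast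
    obtain u1 u2 v1 v2 where uv: "u = (u1, u2)" "v = (v1, v2)"
      and c: "u1 \<in> carrier R" "u2 \<in> carrier R" "v1 \<in> carrier R" "v2 \<in> carrier R"
      using u v by (auto simp: nonzero_vectors_def)
    \<comment> \<open>A second matrix with the same kernel and image is \<open>-outer R u v\<close>, which is \<open>outer R (-u) v\<close>.\<close>
    define u' where "u' = (\<ominus> u1, \<ominus> u2)"
    have u': "u' \<in> ?V" using u(1) c by (auto simp: uv u'_def nonzero_vectors_def neg_eq_zero_iff)
    have "cross R u' u = \<zero>" using c unfolding uv u'_def cross_def fst_conv snd_conv by algebra
    then have i: "line R u' = i" using line_eq_iff u u' by blast
    have neg: "s = \<zero>" if s: "s \<in> carrier R" "\<ominus> s = s" for s
    proof -
      have "s \<oplus> s = \<zero>" using r_neg[OF s(1)] s(2) by simp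
      then have "(\<one> \<oplus> \<one>) \<otimes> s = \<zero>" using s by (simp add: l_distr)
      then show ?thesis using char s(1) by (simp add: integral_iff)
    qed
    have "outer R u v \<noteq> outer R u' v"
    proof
      assume eq: "outer R u v = outer R u' v"
      then have "u1 \<otimes> v1 = \<ominus> u1 \<otimes> v1" "u2 \<otimes> v1 = \<ominus> u2 \<otimes> v1"
        "\<ominus> (u1 \<otimes> v2) = \<ominus> (\<ominus> u1 \<otimes> v2)" "\<ominus> (u2 \<otimes> v2) = \<ominus> (\<ominus> u2 \<otimes> v2)"
        unfolding uv u'_def outer.simps prod.inject by blast+
      then have "\<ominus> (u1 \<otimes> v1) = u1 \<otimes> v1" "\<ominus> (u2 \<otimes> v1) = u2 \<otimes> v1"
        "\<ominus> (\<ominus> (u1 \<otimes> v2)) = \<ominus> (u1 \<otimes> v2)" "\<ominus> (\<ominus> (u2 \<otimes> v2)) = \<ominus> (u2 \<otimes> v2)"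
        using c l_minus by metis+
      then have "u1 \<otimes> v1 = \<zero>" "u2 \<otimes> v1 = \<zero>" "\<ominus> (u1 \<otimes> v2) = \<zero>" "\<ominus> (u2 \<otimes> v2) = \<zero>"
        using c by (metis neg m_closed a_inv_closed)+
      then show False using outer_nonzero[OF u(1) v(1)] by (simp add: uv mat2_ring_def)
    qed
    with u v u' i show "\<exists>x\<in>pverts ?G. \<exists>y\<in>pverts ?G. x \<noteq> y \<and> mat2_kernel R x = k \<and> mat2_image R x = i \<and>
        mat2_kernel R y = k \<and> mat2_image R y = i"
    proof (intro bexI conjI)
      show "outer R u v \<in> pverts ?G" "outer R u' v \<in> pverts ?G"
        unfolding verts using u(1) v(1) u' by blast+
    qed (simp_all add: mat2_kernel_outer mat2_image_outer)
  next
    fix M N assume "M \<in> pverts ?G" "N \<in> pverts ?G"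
    then obtain u v u' v' where M: "M = outer R u v" "u \<in> ?V" "v \<in> ?V"
      and N: "N = outer R u' v'" "u' \<in> ?V" "v' \<in> ?V"
      by (auto simp: verts)
    have "(M, N) \<in> parcs ?G \<longleftrightarrow> M \<noteq> N \<and>
        (M \<otimes>\<^bsub>mat2_ring R\<^esub> N = \<zero>\<^bsub>mat2_ring R\<^esub> \<or> N \<otimes>\<^bsub>mat2_ring R\<^esub> M = \<zero>\<^bsub>mat2_ring R\<^esub>)"
      using \<open>M \<in> pverts ?G\<close> \<open>N \<in> pverts ?G\<close> by (simp add: zero_divisor_graph_def)
    also have "\<dots> \<longleftrightarrow> M \<noteq> N \<and> (line R v = line R u' \<or> line R v' = line R u)"
      using M N by (simp add: outer_mult_zero_iff line_eq_iff)
    finally show "(M, N) \<in> parcs ?G \<longleftrightarrow>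
        M \<noteq> N \<and> (mat2_kernel R M = mat2_image R N \<or> mat2_kernel R N = mat2_image R M)"
      using M N by (simp add: mat2_kernel_outer mat2_image_outer)
  qed
  then show ?thesis using card_lines[OF fin] by simp
qed

end


section \<open>Splitting the quaternions\<close>

text \<open>A square has at most two roots, and zero only one, so more than half of the elements of \<open>F\<close> are
  squares.  Hence the set \<open>S\<close> of squares meets the set \<open>T\<close> of all \<open>-(s + 1)\<close> with \<open>s \<in> S\<close>.\<close>

lemma (in field) exists_minus_one_sum_of_two_squares:
  assumes fin: "finite (carrier R)"
  shows "\<exists>\<alpha>\<in>carrier R. \<exists>\<beta>\<in>carrier R. \<alpha> \<otimes> \<alpha> \<oplus> \<beta> \<otimes> \<beta> \<oplus> \<one> = \<zero>"
proof -
  define S where "S = (\<lambda>x. x \<otimes> x) ` carrier R"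
  define T where "T = (\<lambda>s. \<ominus> (s \<oplus> \<one>)) ` S"
  have sub: "S \<subseteq> carrier R" "T \<subseteq> carrier R" by (auto simp: S_def T_def)
  have finS: "finite S" using fin by (simp add: S_def)
  have "\<zero> \<in> S" unfolding S_def by (rule image_eqI[of _ _ \<zero>]) simp_all
  define Q where "Q s = {x \<in> carrier R. x \<otimes> x = s}" for s
  have Q0: "card (Q \<zero>) \<le> 1"
  proof -
    have "Q \<zero> \<subseteq> {\<zero>}" by (auto simp: Q_def dest: local.integral)
    then show ?thesis using card_mono[of "{\<zero>}" "Q \<zero>"] by simp
  qed
  have Q2: "card (Q s) \<le> 2" if "s \<in> S" for s
  proof -
    obtain r where r: "r \<in> carrier R" "s = r \<otimes> r" using \<open>s \<in> S\<close> by (auto simp: S_def)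
    have "Q s \<subseteq> {r, \<ominus> r}"
    proof
      fix x assume "x \<in> Q s"
      then have x: "x \<in> carrier R" "x \<otimes> x = r \<otimes> r" using r by (auto simp: Q_def)
      have "(x \<ominus> r) \<otimes> (x \<oplus> r) = x \<otimes> x \<ominus> r \<otimes> r" using x(1) r(1) by algebra
      then have "(x \<ominus> r) \<otimes> (x \<oplus> r) = \<zero>" using x r by (simp add: minus_eq r_neg)
      then have "x \<ominus> r = \<zero> \<or> x \<oplus> r = \<zero>" using x(1) r(1) by (intro local.integral) auto
      then show "x \<in> {r, \<ominus> r}" using x(1) r(1) minus_equality by auto
    qed
    then have "card (Q s) \<le> card {r, \<ominus> r}" by (intro card_mono) auto
    also have "\<dots> \<le> 2" by (rule order_trans[OF card_insert_le_m1]) auto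
    finally show ?thesis .
  qed
  have "carrier R = (\<Union>s\<in>S. Q s)" by (auto simp: Q_def S_def)
  then have "card (carrier R) = card (\<Union>s\<in>S. Q s)" by simp
  also have "\<dots> \<le> (\<Sum>s\<in>S. card (Q s))" using finS by (rule card_UN_le)
  also have "\<dots> = card (Q \<zero>) + (\<Sum>s\<in>S - {\<zero>}. card (Q s))"
    using finS \<open>\<zero> \<in> S\<close> by (rule sum.remove)
  also have "\<dots> \<le> 1 + (\<Sum>s\<in>S - {\<zero>}. 2)"
    using Q0 Q2 by (intro add_mono sum_mono) auto
  also have "\<dots> < 2 * card S"
    using finS \<open>\<zero> \<in> S\<close> card_gt_0_iff[of S] by (auto simp: card_Diff_singleton)
  finally have half: "card (carrier R) < 2 * card S" .
  have "inj_on (\<lambda>s. \<ominus> (s \<oplus> \<one>)) S"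
  proof (rule inj_onI)
    fix s s' assume s: "s \<in> S" "s' \<in> S" "\<ominus> (s \<oplus> \<one>) = \<ominus> (s' \<oplus> \<one>)"
    then have c: "s \<in> carrier R" "s' \<in> carrier R" using sub by auto
    have "\<ominus> (\<ominus> (s \<oplus> \<one>)) = \<ominus> (\<ominus> (s' \<oplus> \<one>))" using s(3) by simp
    then have "s \<oplus> \<one> = s' \<oplus> \<one>" using c by simp
    then show "s = s'" using c by simp
  qed
  then have card_T: "card T = card S" unfolding T_def by (rule card_image)
  have "S \<inter> T \<noteq> {}"
  proof
    assume "S \<inter> T = {}"
    then have "card (S \<union> T) = card S + card T" using finS by (intro card_Un_disjoint) (auto simp: T_def)
    moreover have "card (S \<union> T) \<le> card (carrier R)" using fin sub by (intro card_mono) auto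
    ultimately show False using half card_T by simp
  qed
  then obtain \<alpha> \<beta> where \<alpha>\<beta>: "\<alpha> \<in> carrier R" "\<beta> \<in> carrier R" "\<alpha> \<otimes> \<alpha> = \<ominus> (\<beta> \<otimes> \<beta> \<oplus> \<one>)"
    by (auto simp: S_def T_def)
  then have "\<alpha> \<otimes> \<alpha> \<oplus> \<beta> \<otimes> \<beta> \<oplus> \<one> = \<zero>" by (simp add: a_assoc l_neg)
  then show ?thesis using \<alpha>\<beta> by blast
qed

text \<open>For \<open>\<alpha>\<^sup>2 + \<beta>\<^sup>2 = -1\<close> the matrices \<open>(\<alpha>, \<beta>, \<beta>, -\<alpha>)\<close> and \<open>(0, 1, -1, 0)\<close> anticommute and have square
  \<open>-1\<close>; they are the images of \<open>i\<close> and \<open>j\<close>, and their product \<open>(-\<beta>, \<alpha>, \<alpha>, \<beta>)\<close> is that of \<open>k\<close>.\<close>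

fun quat_to_mat2 :: "('a, 'm) ring_scheme \<Rightarrow> 'a \<Rightarrow> 'a \<Rightarrow> 'a quat \<Rightarrow> 'a quat" where
  "quat_to_mat2 R \<alpha> \<beta> (t, x, y, z) =
     (t \<oplus>\<^bsub>R\<^esub> (\<alpha> \<otimes>\<^bsub>R\<^esub> x \<ominus>\<^bsub>R\<^esub> \<beta> \<otimes>\<^bsub>R\<^esub> z), (\<beta> \<otimes>\<^bsub>R\<^esub> x \<oplus>\<^bsub>R\<^esub> \<alpha> \<otimes>\<^bsub>R\<^esub> z) \<oplus>\<^bsub>R\<^esub> y,
      (\<beta> \<otimes>\<^bsub>R\<^esub> x \<oplus>\<^bsub>R\<^esub> \<alpha> \<otimes>\<^bsub>R\<^esub> z) \<ominus>\<^bsub>R\<^esub> y, t \<ominus>\<^bsub>R\<^esub> (\<alpha> \<otimes>\<^bsub>R\<^esub> x \<ominus>\<^bsub>R\<^esub> \<beta> \<otimes>\<^bsub>R\<^esub> z))"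

text \<open>With \<open>m = \<alpha>x - \<beta>z\<close> and \<open>n = \<beta>x + \<alpha>z\<close> the image of \<open>t + xi + yj + zk\<close> is
  \<open>(t + m, n + y, n - y, t - m)\<close>.  The assumption on \<open>\<alpha>\<close> and \<open>\<beta>\<close> enters only through the bilinear
  expressions \<open>mm' + nn'\<close> and \<open>mn' - nm'\<close>, which it turns into \<open>-(xx' + zz')\<close> and \<open>-(xz' - zx')\<close>.\<close>

lemma (in cring) quat_to_mat2_mult:
  assumes \<alpha>\<beta>: "\<alpha> \<in> carrier R" "\<beta> \<in> carrier R" "\<alpha> \<otimes> \<alpha> \<oplus> \<beta> \<otimes> \<beta> \<oplus> \<one> = \<zero>"
    and "p \<in> carrier (quaternion_ring R)" "q \<in> carrier (quaternion_ring R)"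
  shows "quat_to_mat2 R \<alpha> \<beta> (p \<otimes>\<^bsub>quaternion_ring R\<^esub> q) =
    quat_to_mat2 R \<alpha> \<beta> p \<otimes>\<^bsub>mat2_ring R\<^esub> quat_to_mat2 R \<alpha> \<beta> q"
proof -
  obtain t x y z t' x' y' z' where pq: "p = (t, x, y, z)" "q = (t', x', y', z')"
    and car: "t \<in> carrier R" "x \<in> carrier R" "y \<in> carrier R" "z \<in> carrier R"
       "t' \<in> carrier R" "x' \<in> carrier R" "y' \<in> carrier R" "z' \<in> carrier R"
    using assms(4,5) by (auto simp: quaternion_ring_def)
  note c = car \<alpha>\<beta>(1,2)
  define m n m' n' where "m = \<alpha> \<otimes> x \<ominus> \<beta> \<otimes> z" and "n = \<beta> \<otimes> x \<oplus> \<alpha> \<otimes> z"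
    and "m' = \<alpha> \<otimes> x' \<ominus> \<beta> \<otimes> z'" and "n' = \<beta> \<otimes> x' \<oplus> \<alpha> \<otimes> z'"
  note mn = m_def n_def m'_def n'_def
  have cm: "m \<in> carrier R" "n \<in> carrier R" "m' \<in> carrier R" "n' \<in> carrier R"
    using c by (simp_all add: mn)
  have norm: "\<alpha> \<otimes> \<alpha> \<oplus> \<beta> \<otimes> \<beta> = \<ominus> \<one>"
    using \<alpha>\<beta> by (intro minus_equality[symmetric]) (simp_all add: a_comm)
  have "m \<otimes> m' \<oplus> n \<otimes> n' = (\<alpha> \<otimes> \<alpha> \<oplus> \<beta> \<otimes> \<beta>) \<otimes> (x \<otimes> x' \<oplus> z \<otimes> z')"
    using c unfolding mn by algebra
  then have even: "m \<otimes> m' \<oplus> n \<otimes> n' = \<ominus> (x \<otimes> x' \<oplus> z \<otimes> z')"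
    using c norm by (simp add: l_minus)
  have "m \<otimes> n' \<ominus> n \<otimes> m' = (\<alpha> \<otimes> \<alpha> \<oplus> \<beta> \<otimes> \<beta>) \<otimes> (x \<otimes> z' \<ominus> z \<otimes> x')"
    using c unfolding mn by algebra
  then have odd: "m \<otimes> n' \<ominus> n \<otimes> m' = \<ominus> (x \<otimes> z' \<ominus> z \<otimes> x')"
    using c norm by (simp add: l_minus)
  let ?t = "t \<otimes> t' \<ominus> x \<otimes> x' \<ominus> y \<otimes> y' \<ominus> z \<otimes> z'"
  let ?x = "t \<otimes> x' \<oplus> x \<otimes> t' \<oplus> y \<otimes> z' \<ominus> z \<otimes> y'"
  let ?y = "t \<otimes> y' \<ominus> x \<otimes> z' \<oplus> y \<otimes> t' \<oplus> z \<otimes> x'"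
  let ?z = "t \<otimes> z' \<oplus> x \<otimes> y' \<ominus> y \<otimes> x' \<oplus> z \<otimes> t'"
  have x: "\<alpha> \<otimes> ?x \<ominus> \<beta> \<otimes> ?z = t \<otimes> m' \<oplus> m \<otimes> t' \<oplus> (y \<otimes> n' \<ominus> n \<otimes> y')"
    using c unfolding mn by algebra
  have z: "\<beta> \<otimes> ?x \<oplus> \<alpha> \<otimes> ?z = t \<otimes> n' \<oplus> n \<otimes> t' \<ominus> (y \<otimes> m' \<ominus> m \<otimes> y')"
    using c unfolding mn by algebra
  have t: "?t = t \<otimes> t' \<ominus> y \<otimes> y' \<oplus> (m \<otimes> m' \<oplus> n \<otimes> n')"
    using c unfolding even by algebra
  have y: "?y = t \<otimes> y' \<oplus> y \<otimes> t' \<oplus> (m \<otimes> n' \<ominus> n \<otimes> m')"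
    using c unfolding odd by algebra
  have "?t \<oplus> (\<alpha> \<otimes> ?x \<ominus> \<beta> \<otimes> ?z) = (t \<oplus> m) \<otimes> (t' \<oplus> m') \<oplus> (n \<oplus> y) \<otimes> (n' \<ominus> y')"
    using c cm unfolding t x by algebra
  moreover have "(\<beta> \<otimes> ?x \<oplus> \<alpha> \<otimes> ?z) \<oplus> ?y = (t \<oplus> m) \<otimes> (n' \<oplus> y') \<oplus> (n \<oplus> y) \<otimes> (t' \<ominus> m')"
    using c cm unfolding z y by algebra
  moreover have "(\<beta> \<otimes> ?x \<oplus> \<alpha> \<otimes> ?z) \<ominus> ?y = (n \<ominus> y) \<otimes> (t' \<oplus> m') \<oplus> (t \<ominus> m) \<otimes> (n' \<ominus> y')"
    using c cm unfolding z y by algebra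
  moreover have "?t \<ominus> (\<alpha> \<otimes> ?x \<ominus> \<beta> \<otimes> ?z) = (n \<ominus> y) \<otimes> (n' \<oplus> y') \<oplus> (t \<ominus> m) \<otimes> (t' \<ominus> m')"
    using c cm unfolding t x by algebra
  ultimately show ?thesis
    by (simp add: pq quaternion_ring_def mat2_ring_def mn)
qed

text \<open>If the image of \<open>t + xi + yj + zk\<close> is zero, then, as \<open>2\<close> is invertible, \<open>t = y = 0\<close> and
  \<open>m = n = 0\<close>, where \<open>m = \<alpha>x - \<beta>z\<close> and \<open>n = \<beta>x + \<alpha>z\<close>.  The latter system in \<open>x\<close> and \<open>z\<close> has
  determinant \<open>\<alpha>\<^sup>2 + \<beta>\<^sup>2 = -1\<close>, so \<open>x = z = 0\<close>.  An injective map between finite sets of equal size is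
  bijective.\<close>

lemma (in field) quat_to_mat2_ring_iso:
  assumes fin: "finite (carrier R)" and char: "\<one> \<oplus> \<one> \<noteq> \<zero>"
    and \<alpha>\<beta>: "\<alpha> \<in> carrier R" "\<beta> \<in> carrier R" "\<alpha> \<otimes> \<alpha> \<oplus> \<beta> \<otimes> \<beta> \<oplus> \<one> = \<zero>"
  shows "quat_to_mat2 R \<alpha> \<beta> \<in> ring_iso (quaternion_ring R) (mat2_ring R)"
proof -
  let ?\<phi> = "quat_to_mat2 R \<alpha> \<beta>"
  interpret Q: ring "quaternion_ring R" by (rule ring_quaternion_ring) (rule cring_axioms)
  interpret M: ring "mat2_ring R" by (rule ring_mat2_ring)
  have hom: "?\<phi> \<in> ring_hom (quaternion_ring R) (mat2_ring R)"
  proof (rule ring_hom_memI)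
    fix p q assume pq: "p \<in> carrier (quaternion_ring R)" "q \<in> carrier (quaternion_ring R)"
    show "?\<phi> p \<in> carrier (mat2_ring R)"
      using pq(1) \<alpha>\<beta>(1,2) by (auto simp: quaternion_ring_def mat2_ring_def)
    show "?\<phi> (p \<otimes>\<^bsub>quaternion_ring R\<^esub> q) = ?\<phi> p \<otimes>\<^bsub>mat2_ring R\<^esub> ?\<phi> q"
      using \<alpha>\<beta> pq by (rule quat_to_mat2_mult)
    obtain t x y z t' x' y' z' where pq': "p = (t, x, y, z)" "q = (t', x', y', z')"
      and c: "t \<in> carrier R" "x \<in> carrier R" "y \<in> carrier R" "z \<in> carrier R"
        "t' \<in> carrier R" "x' \<in> carrier R" "y' \<in> carrier R" "z' \<in> carrier R"
      using pq by (auto simp: quaternion_ring_def)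
    have "t \<oplus> t' \<oplus> (\<alpha> \<otimes> (x \<oplus> x') \<ominus> \<beta> \<otimes> (z \<oplus> z')) =
          t \<oplus> (\<alpha> \<otimes> x \<ominus> \<beta> \<otimes> z) \<oplus> (t' \<oplus> (\<alpha> \<otimes> x' \<ominus> \<beta> \<otimes> z'))"
      "t \<oplus> t' \<ominus> (\<alpha> \<otimes> (x \<oplus> x') \<ominus> \<beta> \<otimes> (z \<oplus> z')) =
          t \<ominus> (\<alpha> \<otimes> x \<ominus> \<beta> \<otimes> z) \<oplus> (t' \<ominus> (\<alpha> \<otimes> x' \<ominus> \<beta> \<otimes> z'))"
      using c \<alpha>\<beta>(1,2) by algebra+
    moreover have "\<beta> \<otimes> (x \<oplus> x') \<oplus> \<alpha> \<otimes> (z \<oplus> z') \<oplus> (y \<oplus> y') =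
          \<beta> \<otimes> x \<oplus> \<alpha> \<otimes> z \<oplus> y \<oplus> (\<beta> \<otimes> x' \<oplus> \<alpha> \<otimes> z' \<oplus> y')"
      "\<beta> \<otimes> (x \<oplus> x') \<oplus> \<alpha> \<otimes> (z \<oplus> z') \<ominus> (y \<oplus> y') =
          \<beta> \<otimes> x \<oplus> \<alpha> \<otimes> z \<ominus> y \<oplus> (\<beta> \<otimes> x' \<oplus> \<alpha> \<otimes> z' \<ominus> y')"
      using c \<alpha>\<beta>(1,2) by algebra+
    ultimately show "?\<phi> (p \<oplus>\<^bsub>quaternion_ring R\<^esub> q) = ?\<phi> p \<oplus>\<^bsub>mat2_ring R\<^esub> ?\<phi> q"
      by (simp add: pq' quaternion_ring_def mat2_ring_def)
  next
    show "?\<phi> \<one>\<^bsub>quaternion_ring R\<^esub> = \<one>\<^bsub>mat2_ring R\<^esub>"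
      using \<alpha>\<beta>(1,2) by (simp add: quaternion_ring_def mat2_ring_def minus_eq)
  qed
  have norm: "\<alpha> \<otimes> \<alpha> \<oplus> \<beta> \<otimes> \<beta> = \<ominus> \<one>"
    using \<alpha>\<beta> by (intro minus_equality[symmetric]) (simp_all add: a_comm)
  have double: "u = \<zero>" if "u \<oplus> u = \<zero>" "u \<in> carrier R" for u
  proof -
    have "(\<one> \<oplus> \<one>) \<otimes> u = \<zero>" using that by (simp add: l_distr)
    then show ?thesis using char that(2) integral_iff by auto
  qed
  have "inj_on ?\<phi> (carrier (quaternion_ring R))"
  proof -
    have "q = \<zero>\<^bsub>quaternion_ring R\<^esub>"
      if q: "q \<in> carrier (quaternion_ring R)" "?\<phi> q = \<zero>\<^bsub>mat2_ring R\<^esub>" for q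
    proof -
      obtain t x y z where q': "q = (t, x, y, z)"
        and c: "t \<in> carrier R" "x \<in> carrier R" "y \<in> carrier R" "z \<in> carrier R"
        using q(1) by (auto simp: quaternion_ring_def)
      define m n where "m = \<alpha> \<otimes> x \<ominus> \<beta> \<otimes> z" and "n = \<beta> \<otimes> x \<oplus> \<alpha> \<otimes> z"
      have cm: "m \<in> carrier R" "n \<in> carrier R" using c \<alpha>\<beta> by (simp_all add: m_def n_def)
      have eqs: "t \<oplus> m = \<zero>" "n \<oplus> y = \<zero>" "n \<ominus> y = \<zero>" "t \<ominus> m = \<zero>"
        using q(2) by (simp_all add: q' m_def n_def mat2_ring_def)
      have "t = m" "n = y" using eqs(3,4) c cm by simp_all
      then have "t \<oplus> t = \<zero>" "m \<oplus> m = \<zero>" "n \<oplus> n = \<zero>" "y \<oplus> y = \<zero>"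
        using eqs(1,2) by blast+
      then have zero: "t = \<zero>" "m = \<zero>" "n = \<zero>" "y = \<zero>"
        using c cm by (blast intro: double)+
      have "(\<alpha> \<otimes> \<alpha> \<oplus> \<beta> \<otimes> \<beta>) \<otimes> x = \<alpha> \<otimes> m \<oplus> \<beta> \<otimes> n"
        using c \<alpha>\<beta>(1,2) unfolding m_def n_def by algebra
      then have x: "\<ominus> x = \<zero>" using c \<alpha>\<beta>(1,2) by (simp add: norm zero l_minus)
      have "(\<alpha> \<otimes> \<alpha> \<oplus> \<beta> \<otimes> \<beta>) \<otimes> z = \<alpha> \<otimes> n \<ominus> \<beta> \<otimes> m"
        using c \<alpha>\<beta>(1,2) unfolding m_def n_def by algebra
      then have "\<ominus> z = \<zero>" using c \<alpha>\<beta>(1,2) by (simp add: norm zero l_minus minus_eq)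
      with x have "\<ominus> (\<ominus> x) = \<zero>" "\<ominus> (\<ominus> z) = \<zero>" by simp_all
      then have "x = \<zero>" "z = \<zero>" using c by simp_all
      then show ?thesis using zero by (simp add: q' quaternion_ring_def)
    qed
    note trivial = this
    interpret \<phi>: ring_hom_ring "quaternion_ring R" "mat2_ring R" ?\<phi>
      using Q.ring_axioms M.ring_axioms hom by (rule ring_hom_ringI2)
    show ?thesis
    proof (rule \<phi>.trivial_ker_imp_inj, rule equalityI)
      show "a_kernel (quaternion_ring R) (mat2_ring R) ?\<phi> \<subseteq> {\<zero>\<^bsub>quaternion_ring R\<^esub>}"
        unfolding a_kernel_def' using trivial by blast
      show "{\<zero>\<^bsub>quaternion_ring R\<^esub>} \<subseteq> a_kernel (quaternion_ring R) (mat2_ring R) ?\<phi>"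
        unfolding a_kernel_def' using Q.zero_closed \<phi>.hom_zero by blast
    qed
  qed
  moreover have "?\<phi> ` carrier (quaternion_ring R) \<subseteq> carrier (quaternion_ring R)"
    using \<alpha>\<beta>(1,2) by (auto simp: quaternion_ring_def)
  moreover have "finite (carrier (quaternion_ring R))"
    using fin by (simp add: quaternion_ring_def)
  ultimately have "bij_betw ?\<phi> (carrier (quaternion_ring R)) (carrier (quaternion_ring R))"
    by (simp add: bij_betw_def endo_inj_surj)
  then have "bij_betw ?\<phi> (carrier (quaternion_ring R)) (carrier (mat2_ring R))"
    by (simp add: mat2_ring_def quaternion_ring_def)
  then show ?thesis using hom by (simp add: ring_iso_def)
qed


section \<open>The domination number\<close>

lemma domination_number_iso:
  assumes "bij_betw h (pverts G) (pverts H)"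
    and "\<And>u v. u \<in> pverts G \<Longrightarrow> v \<in> pverts G \<Longrightarrow> (u, v) \<in> parcs G \<longleftrightarrow> (h u, h v) \<in> parcs H"
  shows "domination_number G = domination_number H"
proof -
  have transport: "\<exists>E. dominating_set H' E \<and> finite E \<and> card E = card D"
    if h: "bij_betw h (pverts G') (pverts H')"
      and arcs: "\<And>u v. u \<in> pverts G' \<Longrightarrow> v \<in> pverts G' \<Longrightarrow> (u, v) \<in> parcs G' \<longleftrightarrow> (h u, h v) \<in> parcs H'"
      and D: "dominating_set G' D" "finite D"
    for G' :: "'c pair_pre_digraph" and H' :: "'d pair_pre_digraph" and h D
  proof (intro exI conjI)
    have sub: "D \<subseteq> pverts G'" using D(1) by (simp add: dominating_set_def)
    show "card (h ` D) = card D"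
      using h sub by (intro card_image) (auto simp: bij_betw_def intro: inj_on_subset)
    show "finite (h ` D)" using D(2) by simp
    show "dominating_set H' (h ` D)" unfolding dominating_set_def
    proof (intro conjI ballI)
      show "h ` D \<subseteq> pverts H'" using sub h by (auto simp: bij_betw_def)
      fix w assume w: "w \<in> pverts H' - h ` D"
      then obtain v where v: "v \<in> pverts G'" "w = h v" using h by (auto simp: bij_betw_def)
      then have "v \<in> pverts G' - D" using w by blast
      then obtain u where "u \<in> D" "(u, v) \<in> parcs G'"
        using D(1) by (auto simp: dominating_set_def)
      then show "\<exists>u\<in>h ` D. (u, w) \<in> parcs H'" using arcs v sub by blast
    qed
  qed
  let ?g = "inv_into (pverts G) h"
  have g: "bij_betw ?g (pverts H) (pverts G)" using assms(1) by (rule bij_betw_inv_into)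
  have g_arcs: "(u, v) \<in> parcs H \<longleftrightarrow> (?g u, ?g v) \<in> parcs G" if "u \<in> pverts H" "v \<in> pverts H" for u v
    using assms(2)[of "?g u" "?g v"] that bij_betw_inv_into_right[OF assms(1)] bij_betw_apply[OF g]
    by simp
  have "(\<exists>D. dominating_set G D \<and> finite D \<and> card D = n) \<longleftrightarrow>
        (\<exists>D. dominating_set H D \<and> finite D \<and> card D = n)" for n
  proof
    assume "\<exists>D. dominating_set G D \<and> finite D \<and> card D = n"
    then show "\<exists>D. dominating_set H D \<and> finite D \<and> card D = n"
      using transport[OF assms] by blast
  next
    assume "\<exists>D. dominating_set H D \<and> finite D \<and> card D = n"
    then show "\<exists>D. dominating_set G D \<and> finite D \<and> card D = n"
      using transport[OF g g_arcs] by blast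
  qed
  then show ?thesis by (simp add: domination_number_def)
qed

lemma domination_number_zero_divisor_graph_ring_iso:
  fixes R :: "('a, 'm) ring_scheme" and S :: "('b, 'n) ring_scheme" and h :: "'a \<Rightarrow> 'b"
  assumes "ring R" "ring S" and h: "h \<in> ring_iso R S"
  shows "domination_number (zero_divisor_graph R) = domination_number (zero_divisor_graph S)"
proof (rule domination_number_iso[where h = h])
  interpret R: ring R by fact
  interpret S: ring S by fact
  have bij: "bij_betw h (carrier R) (carrier S)" and hom: "h \<in> ring_hom R S"
    using h by (auto simp: ring_iso_def)
  have zero: "h \<zero>\<^bsub>R\<^esub> = \<zero>\<^bsub>S\<^esub>" using hom R.ring_axioms S.ring_axioms by (rule ring_hom_zero)
  have inj: "h x = h y \<longleftrightarrow> x = y" if "x \<in> carrier R" "y \<in> carrier R" for x y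
    using bij that by (auto simp: bij_betw_def inj_on_def)
  have eq_zero: "h x = \<zero>\<^bsub>S\<^esub> \<longleftrightarrow> x = \<zero>\<^bsub>R\<^esub>" if "x \<in> carrier R" for x
    using inj[OF that R.zero_closed] zero by simp
  have prod: "h x \<otimes>\<^bsub>S\<^esub> h y = \<zero>\<^bsub>S\<^esub> \<longleftrightarrow> x \<otimes>\<^bsub>R\<^esub> y = \<zero>\<^bsub>R\<^esub>" if "x \<in> carrier R" "y \<in> carrier R" for x y
    using ring_hom_mult[OF hom that] eq_zero that by (metis R.m_closed)
  have carrier_S: "carrier S = h ` carrier R" using bij by (simp add: bij_betw_def)
  have zd: "h x \<in> zero_divisors S \<longleftrightarrow> x \<in> zero_divisors R" if x: "x \<in> carrier R" for x
  proof -
    have "h x \<in> zero_divisors S \<longleftrightarrow> (\<exists>y\<in>carrier R. h y \<noteq> \<zero>\<^bsub>S\<^esub> \<and>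
        (h x \<otimes>\<^bsub>S\<^esub> h y = \<zero>\<^bsub>S\<^esub> \<or> h y \<otimes>\<^bsub>S\<^esub> h x = \<zero>\<^bsub>S\<^esub>))"
      unfolding zero_divisors_def carrier_S using x by blast
    then show ?thesis using x by (simp add: zero_divisors_def prod eq_zero cong: bex_cong)
  qed
  have "h ` pverts (zero_divisor_graph R) = pverts (zero_divisor_graph S)"
  proof
    show "h ` pverts (zero_divisor_graph R) \<subseteq> pverts (zero_divisor_graph S)"
      using zd eq_zero by (auto simp: zero_divisor_graph_def zero_divisors_def)
    show "pverts (zero_divisor_graph S) \<subseteq> h ` pverts (zero_divisor_graph R)"
    proof
      fix y assume y: "y \<in> pverts (zero_divisor_graph S)"
      then obtain x where x: "x \<in> carrier R" "y = h x"
        by (auto simp: zero_divisor_graph_def zero_divisors_def carrier_S)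
      then have "x \<in> pverts (zero_divisor_graph R)"
        using y zd eq_zero by (auto simp: zero_divisor_graph_def)
      then show "y \<in> h ` pverts (zero_divisor_graph R)" using x by blast
    qed
  qed
  then show "bij_betw h (pverts (zero_divisor_graph R)) (pverts (zero_divisor_graph S))"
    using bij by (auto simp: bij_betw_def zero_divisor_graph_def zero_divisors_def intro: inj_on_subset)
  show "(u, v) \<in> parcs (zero_divisor_graph R) \<longleftrightarrow> (h u, h v) \<in> parcs (zero_divisor_graph S)"
    if "u \<in> pverts (zero_divisor_graph R)" "v \<in> pverts (zero_divisor_graph R)" for u v
  proof -
    have "u \<in> carrier R" "v \<in> carrier R"
      using that by (auto simp: zero_divisor_graph_def zero_divisors_def)
    then show ?thesis using zd eq_zero prod inj by (auto simp: zero_divisor_graph_def)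
  qed
qed

theorem (in field) domination_number_quaternion_ring:
  assumes "finite (carrier R)" and "\<one> \<oplus> \<one> \<noteq> \<zero>"
  shows "domination_number (zero_divisor_graph (quaternion_ring R)) = card (carrier R) + 1"
proof -
  obtain \<alpha> \<beta> where "\<alpha> \<in> carrier R" "\<beta> \<in> carrier R" "\<alpha> \<otimes> \<alpha> \<oplus> \<beta> \<otimes> \<beta> \<oplus> \<one> = \<zero>"
    using exists_minus_one_sum_of_two_squares[OF assms(1)] by blast
  then have "quat_to_mat2 R \<alpha> \<beta> \<in> ring_iso (quaternion_ring R) (mat2_ring R)"
    using assms by (intro quat_to_mat2_ring_iso)
  then have "domination_number (zero_divisor_graph (quaternion_ring R)) =
      domination_number (zero_divisor_graph (mat2_ring R))"
    using ring_quaternion_ring[OF cring_axioms] ring_mat2_ring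
    by (intro domination_number_zero_divisor_graph_ring_iso)
  then show ?thesis using domination_number_mat2_ring assms by simp
qed

theorem theorem12:
  fixes p :: nat
  assumes "prime p" and "odd p"
  shows "domination_number (zero_divisor_graph (lipschitz_quaternions_mod p)) = p + 1"
proof -
  have "p > 2" using prime_gt_1_nat[OF assms(1)] assms(2) by (cases "p = 2") auto
  interpret residues_prime p "residue_ring (int p)"
    by unfold_locales (use assms \<open>p > 2\<close> in auto)
  have "\<one>\<^bsub>residue_ring (int p)\<^esub> \<oplus>\<^bsub>residue_ring (int p)\<^esub> \<one>\<^bsub>residue_ring (int p)\<^esub> \<noteq> \<zero>\<^bsub>residue_ring (int p)\<^esub>"
    using \<open>p > 2\<close> by (simp add: res_add_eq res_one_eq res_zero_eq)
  moreover have "card (carrier (residue_ring (int p))) = p" by (simp add: res_carrier_eq)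
  ultimately show ?thesis using domination_number_quaternion_ring by simp
qed

end
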